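(* The algorithm Eag has competitive function $\frac{n}{2}$.
   Context: Online frequent items problem: an input sequence is $I=a_1,\ldots,a_n$ of items from an infinite universe, $n=|I|$, revealed one at a time. An algorithm maintains a buffer holding one item; $s_t$ is the buffer content after step $t$; at step $1$ the buffer receives $a_1$, and at each later step $t$ the algorithm either keeps $s_{t-1}$ or replaces it by $a_t$. With $f_I(a)=|\{i:a_i=a\}|/n$, the aggregate frequency of $\mathcal A$ on $I$ is $\mathcal A(I)=\sum_{t=1}^n f_I(s^{\mathcal A}_t)$ (to be maximized). Opt denotes an optimal offline algorithm (knows all of $I$ in advance, same buffer rules). Eag: let $t^*=\min\{t\in\{1,\ldots,n-1\}: a_t=a_{t+1}\}$ if such $t$ exists, else $t^*=n$; Eag sets $s_t=a_t$ for $t\le t^*$ and $s_t=a_{t^*}$ for $t>t^*$. Competitive function: $\mathcal A$ is $f(n)$-competitive if there is $h\in o(f)$ such that for all $I$ (with $n=|I|$), $\mathrm{Opt}(I)\le (f(n)+h(n))\,\mathcal A(I)$. $\mathcal A$ has competitive function $f(n)$ if it is $f(n)$-competitive and for every $g(n)$ such that $\mathcal A$ is $g(n)$-competitive, $\lim_{n\to\infty} f(n)/g(n)\le 1$. *)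

theory Defs
  imports Complex_Main "HOL-Library.Landau_Symbols" "HOL-Library.Extended_Real"
    "HOL-Library.Liminf_Limsup" "HOL-Library.Infinite_Typeclass"
begin

text \<open>Inputs and buffer contents are lists. Lists are indexed from 0, so \<open>I ! t\<close> and \<open>s ! t\<close> are
  the item revealed in step \<open>t + 1\<close> and the buffer content after that step.\<close>

definition freq :: "'a list \<Rightarrow> 'a \<Rightarrow> real" where
  "freq I a = real (count_list I a) / real (length I)"

definition buffer_sequence :: "'a list \<Rightarrow> 'a list \<Rightarrow> bool" where
  "buffer_sequence I s \<longleftrightarrow>
     length s = length I \<and>
     (\<forall>t<length I. if t = 0 then s ! t = I ! t else s ! t = s ! (t - 1) \<or> s ! t = I ! t)"

definition aggregate_freq :: "'a list \<Rightarrow> 'a list \<Rightarrow> real" where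
  "aggregate_freq I s = (\<Sum>t<length I. freq I (s ! t))"

definition opt :: "'a list \<Rightarrow> real" where
  "opt I = Max {aggregate_freq I s | s. buffer_sequence I s}"

text \<open>An algorithm maps an input to the sequence of its buffer contents; it is online if the
  contents up to any step depend only on the items revealed so far.\<close>

type_synonym 'a algorithm = "'a list \<Rightarrow> 'a list"

definition online_algorithm :: "'a algorithm \<Rightarrow> bool" where
  "online_algorithm A \<longleftrightarrow>
     (\<forall>I. buffer_sequence I (A I)) \<and> (\<forall>I k. k \<le> length I \<longrightarrow> A (take k I) = take k (A I))"

definition eag_stop :: "'a list \<Rightarrow> nat" where
  "eag_stop I =
     (if \<exists>t. t + 1 < length I \<and> I ! t = I ! (t + 1)
      then LEAST t. t + 1 < length I \<and> I ! t = I ! (t + 1)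
      else length I - 1)"

definition eag :: "'a algorithm" where
  "eag I = map (\<lambda>t. if t \<le> eag_stop I then I ! t else I ! eag_stop I) [0..<length I]"

definition competitive :: "'a algorithm \<Rightarrow> (nat \<Rightarrow> real) \<Rightarrow> bool" where
  "competitive A f \<longleftrightarrow>
     (\<exists>h \<in> o(f). \<forall>I. I \<noteq> [] \<longrightarrow>
        opt I \<le> (f (length I) + h (length I)) * aggregate_freq I (A I))"

text \<open>The requirement that the limit of \<open>f n / g n\<close> be at most 1 is read as a bound on the limit
  superior: the limit itself need not exist, since competitiveness is preserved when \<open>g\<close> is doubled
  at, say, all even \<open>n\<close>.\<close>

definition has_competitive_function :: "'a algorithm \<Rightarrow> (nat \<Rightarrow> real) \<Rightarrow> bool" where
  "has_competitive_function A f \<longleftrightarrow>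
     competitive A f \<and>
     (\<forall>g. competitive A g \<longrightarrow> limsup (\<lambda>n. ereal (f n / g n)) \<le> 1)"

lemma finite_aggregate_freqs: "finite {aggregate_freq I s | s. buffer_sequence I s}"
proof -
  have "set s \<subseteq> set I \<and> length s = length I" if s: "buffer_sequence I s" for s
  proof -
    have len: "length s = length I"
      using s by (simp add: buffer_sequence_def)
    have "s ! t \<in> set I" if "t < length I" for t
      using that
    proof (induction t)
      case 0
      then show ?case using s by (auto simp: buffer_sequence_def)
    next
      case (Suc t)
      then have "s ! Suc t = s ! t \<or> s ! Suc t = I ! Suc t"
        using s by (auto simp: buffer_sequence_def)
      then show ?case using Suc by auto
    qed
    then show ?thesis using len by (auto simp: in_set_conv_nth)
  qed
  then have "{s. buffer_sequence I s} \<subseteq> {s. set s \<subseteq> set I \<and> length s = length I}"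
    by auto
  then have "finite {s. buffer_sequence I s}"
    by (rule finite_subset) (simp add: finite_lists_length_eq)
  then show ?thesis
    by simp
qed

lemma aggregate_freqs_nonempty: "{aggregate_freq I s | s. buffer_sequence I s} \<noteq> {}"
proof -
  have "buffer_sequence I I" by (simp add: buffer_sequence_def)
  then show ?thesis by blast
qed

lemma eag_stop_take:
  assumes k: "k \<le> length I" and t: "t < k"
  shows "min t (eag_stop (take k I)) = min t (eag_stop I)"
proof -
  let ?P = "\<lambda>J t. t + 1 < length J \<and> J ! t = J ! (t + 1)"
  have P: "?P (take k I) u \<longleftrightarrow> u + 1 < k \<and> ?P I u" for u
    using k by auto
  show ?thesis
  proof (cases "\<exists>u. ?P (take k I) u")
    case True
    define u where "u = (LEAST u. ?P (take k I) u)"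
    have u: "?P (take k I) u"
      unfolding u_def using True by (rule LeastI_ex)
    have "(LEAST u. ?P I u) = u"
    proof (rule Least_equality)
      show "?P I u" using u P by blast
      show "u \<le> v" if "?P I v" for v
      proof (rule ccontr)
        assume "\<not> u \<le> v"
        then have "?P (take k I) v" using that u P[of v] P[of u] by linarith
        then have "u \<le> v" unfolding u_def by (rule Least_le)
        with \<open>\<not> u \<le> v\<close> show False by simp
      qed
    qed
    moreover have "\<exists>u. ?P I u" using u P by blast
    ultimately have "eag_stop I = u" unfolding eag_stop_def by simp
    moreover have "eag_stop (take k I) = u"
      using True unfolding eag_stop_def u_def by (simp only: if_True)
    ultimately show ?thesis by simp
  next
    case False
    then have *: "eag_stop (take k I) = k - 1"
      using k unfolding eag_stop_def by (simp only: if_False) simp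
    have "t \<le> eag_stop I"
    proof (cases "\<exists>u. ?P I u")
      case True
      then have "?P I (LEAST u. ?P I u)" by (rule LeastI_ex)
      then have "\<not> (LEAST u. ?P I u) + 1 < k" using False P by blast
      moreover have "eag_stop I = (LEAST u. ?P I u)"
        using True unfolding eag_stop_def by (simp only: if_True)
      ultimately show ?thesis using t by linarith
    next
      case False
      then have "eag_stop I = length I - 1"
        unfolding eag_stop_def by (simp only: if_False)
      then show ?thesis using k t by linarith
    qed
    then show ?thesis using * t by simp
  qed
qed

lemma eag_alt: "eag I = map (\<lambda>t. I ! min t (eag_stop I)) [0..<length I]"
  by (auto simp: eag_def min_def)

lemma online_algorithm_eag: "online_algorithm eag"
  unfolding online_algorithm_def
proof (intro conjI allI impI)
  fix I :: "'a list"
  show "buffer_sequence I (eag I)"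
    by (auto simp: buffer_sequence_def eag_def not_le dest: less_imp_Suc_add)
next
  fix I :: "'a list" and k :: nat
  assume k: "k \<le> length I"
  have "take k I ! min t (eag_stop (take k I)) = I ! min t (eag_stop I)" if "t < k" for t
    using eag_stop_take[OF k that] that by simp
  then show "eag (take k I) = take k (eag I)"
    using k by (intro nth_equalityI) (auto simp: eag_alt)
qed

end

theory Submission imports Defs "HOL-Real_Asymp.Real_Asymp" begin

text \<open>Let \<open>m\<close> be the largest number of occurrences of an item \<open>b\<close> in an input of length \<open>n \<ge> 2\<close>.
  The optimum is at most \<open>m\<close>, so for the upper bound it suffices that the multiplicities of the
  items in the buffer of Eag add up to at least \<open>2 m\<close>. Suppose Eag keeps the item of step \<open>p + 1\<close> and
  that \<open>b\<close> occurs \<open>r\<close> times before. The first \<open>p\<close> steps contribute at least \<open>r m + (p - r)\<close>, and the remaining \<open>n - p\<close> steps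
  contribute at least \<open>2\<close> each because the item kept occurs twice. Now \<open>m \<le> r + (n - p)\<close> and
  \<open>m \<le> n\<close> give the claim. If Eag never stops, the same count works with \<open>p = n\<close> and \<open>r = m\<close>.

  For the lower bound, on \<open>x, x, b, \<dots>, b\<close> Eag only collects \<open>2\<close>, whereas always taking the new
  item collects at least \<open>(n - 2)\<^sup>2 / n\<close>.\<close>

section \<open>Occurrence counts and bounds on the optimum\<close>

lemma aggregate_freq_eq_sum_count:
  "aggregate_freq I s = real (\<Sum>t<length I. count_list I (s ! t)) / real (length I)"
  by (simp add: aggregate_freq_def freq_def sum_divide_distrib)

lemma count_list_le_length: "count_list xs x \<le> length xs"
  by (induction xs) auto

lemma count_list_pos: "x \<in> set xs \<Longrightarrow> 1 \<le> count_list xs x"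
  by (induction xs) auto

lemma obtain_most_frequent:
  obtains b where "\<And>x. count_list I x \<le> count_list I b"
proof -
  have "\<exists>b. True \<and> (\<forall>x. True \<longrightarrow> count_list I x \<le> count_list I b)"
    by (rule ex_has_greatest_nat[where b = "Suc (length I)"])
      (auto simp: count_list_le_length less_Suc_eq_le)
  then show thesis using that by blast
qed

text \<open>There are \<open>length I\<close> steps, and each contributes a frequency of at most
  \<open>m / length I\<close>.\<close>

lemma opt_le_max_count:
  assumes "I \<noteq> []" and m: "\<And>x. count_list I x \<le> m"
  shows "opt I \<le> real m"
  unfolding opt_def
proof (rule Max.boundedI[OF finite_aggregate_freqs aggregate_freqs_nonempty])
  fix v
  assume "v \<in> {aggregate_freq I s | s. buffer_sequence I s}"
  then obtain s where v: "v = aggregate_freq I s" by auto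
  have "(\<Sum>t<length I. count_list I (s ! t)) \<le> length I * m"
    using sum_bounded_above[of "{..<length I}" "\<lambda>t. count_list I (s ! t)" m] m by simp
  then have "real (\<Sum>t<length I. count_list I (s ! t)) \<le> real (length I) * real m"
    by (metis of_nat_le_iff of_nat_mult)
  then show "v \<le> real m"
    using assms(1) by (simp add: v aggregate_freq_eq_sum_count divide_le_eq mult.commute)
qed

lemma aggregate_freq_le_opt: "buffer_sequence I s \<Longrightarrow> aggregate_freq I s \<le> opt I"
  unfolding opt_def by (rule Max_ge[OF finite_aggregate_freqs]) auto

text \<open>Each occurrence of \<open>b\<close> contributes \<open>c b\<close> and each other entry
  at least 1. The count of \<open>b\<close> is added on the right to avoid truncated
  subtraction.\<close>

lemma sum_list_ge_count:
  fixes c :: "'a \<Rightarrow> nat"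
  assumes "\<And>x. x \<in> set xs \<Longrightarrow> 1 \<le> c x"
  shows "count_list xs b * c b + length xs \<le> sum_list (map c xs) + count_list xs b"
  using assms by (induction xs) force+

lemma sum_nth_take:
  assumes "p \<le> length I"
  shows "(\<Sum>t<p. c (I ! t)) = sum_list (map c (take p I))"
  using assms by (simp add: sum_list_sum_nth atLeast0LessThan)

lemma two_le_count_adjacent:
  assumes "p + 1 < length I" "I ! p = I ! (p + 1)"
  shows "2 \<le> count_list I (I ! p)"
proof -
  have "drop p I = I ! p # I ! (p + 1) # drop (p + 2) I"
    using assms(1) by (simp add: Cons_nth_drop_Suc)
  then have "I = take p I @ I ! p # I ! p # drop (p + 2) I"
    using append_take_drop_id[of p I] assms(2) by simp
  then have "count_list I (I ! p) = count_list (take p I @ I ! p # I ! p # drop (p + 2) I) (I ! p)"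
    by simp
  then show ?thesis by simp
qed

section \<open>Upper bound: multiplicities in the buffer of Eag\<close>

lemma two_max_count_le_eag_sum:
  assumes n: "2 \<le> length I" and b: "\<And>x. count_list I x \<le> count_list I b"
  shows "2 * count_list I b \<le> (\<Sum>t<length I. count_list I (eag I ! t))"
proof -
  define n where "n = length I"
  define m where "m = count_list I b"
  define c where "c = count_list I"
  define p where "p = eag_stop I"
  have S: "(\<Sum>t<length I. count_list I (eag I ! t)) = (\<Sum>t<n. c (I ! min t p))"
    by (simp add: eag_alt n_def c_def p_def)
  \<comment> \<open>Applied with \<open>q = p\<close> if Eag stops early and with
    \<open>q = n\<close> otherwise.\<close>
  have prefix: "count_list (take q I) b * m + q \<le> (\<Sum>t<q. c (I ! t)) + count_list (take q I) b"
    if "q \<le> n" for q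
  proof -
    have "1 \<le> c x" if "x \<in> set (take q I)" for x
      unfolding c_def using that by (intro count_list_pos) (rule in_set_takeD)
    from sum_list_ge_count[of "take q I" c b, OF this] show ?thesis
      using that by (simp add: sum_nth_take n_def m_def c_def)
  qed
  have mn: "m \<le> n"
    unfolding m_def n_def by (rule count_list_le_length)
  have "2 * m \<le> (\<Sum>t<n. c (I ! min t p))"
  proof (cases "\<exists>t. t + 1 < length I \<and> I ! t = I ! (t + 1)")
    case True
    then have p: "p = (LEAST t. t + 1 < length I \<and> I ! t = I ! (t + 1))"
      unfolding p_def eag_stop_def by (simp only: if_True)
    have adj: "p + 1 < length I \<and> I ! p = I ! (p + 1)"
      unfolding p by (rule LeastI_ex[OF True])
    then have pn: "p < n" and cp: "2 \<le> c (I ! p)"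
      using two_le_count_adjacent[of p I] by (auto simp: n_def c_def)
    have m2: "2 \<le> m"
      using cp b[of "I ! p"] by (simp add: c_def m_def)
    define r where "r = count_list (take p I) b"
    have "m = r + count_list (drop p I) b"
      unfolding m_def r_def by (metis append_take_drop_id count_list_append)
    then have mr: "m \<le> r + (n - p)"
      using count_list_le_length[of "drop p I" b] by (simp add: n_def)
    have "(\<Sum>t<n. c (I ! min t p)) = (\<Sum>t<p. c (I ! min t p)) + (\<Sum>t=p..<n. c (I ! min t p))"
      using sum.atLeastLessThan_concat[of 0 p n "\<lambda>t. c (I ! min t p)"] pn
      by (simp add: atLeast0LessThan)
    also have "\<dots> = (\<Sum>t<p. c (I ! t)) + (n - p) * c (I ! p)"
      by simp
    finally have "(\<Sum>t<n. c (I ! min t p)) = (\<Sum>t<p. c (I ! t)) + (n - p) * c (I ! p)" .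
    moreover have "(n - p) * 2 \<le> (n - p) * c (I ! p)"
      using cp by (rule mult_le_mono2)
    moreover have "r * 2 \<le> r * m"
      using m2 by (rule mult_le_mono2)
    \<comment> \<open>The total is at least
      \<open>2 * r + (p - r) + 2 * (n - p) = (r + (n - p)) + n\<close>, and both
      \<open>r + (n - p)\<close> and \<open>n\<close> are at least \<open>m\<close>.\<close>
    ultimately show ?thesis
      using prefix[of p] pn mr mn unfolding r_def[symmetric] by linarith
  next
    case False
    \<comment> \<open>The default stop is the last index, so \<open>min t p = t\<close> at every
      step.\<close>
    then have "p = n - 1"
      unfolding p_def eag_stop_def n_def by (simp only: if_False)
    then have "(\<Sum>t<n. c (I ! min t p)) = (\<Sum>t<n. c (I ! t))"
      by (intro sum.cong) (auto simp: min_def)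
    moreover have "m * m + n \<le> (\<Sum>t<n. c (I ! t)) + m"
      using prefix[of n] by (simp add: n_def m_def)
    \<comment> \<open>For \<open>m \<le> 1\<close> this rests on \<open>2 \<le> n\<close>; it fails
      for inputs of length 1.\<close>
    moreover have "3 * m \<le> m * m + n"
    proof (cases "2 \<le> m")
      case True
      then have "2 * m \<le> m * m" by (rule mult_le_mono1)
      then show ?thesis using mn by linarith
    next
      case False
      then have "m = 0 \<or> m = 1" by auto
      then show ?thesis using n unfolding n_def[symmetric] by auto
    qed
    ultimately show ?thesis by linarith
  qed
  then show ?thesis
    by (simp add: S m_def)
qed

lemma opt_le_half_length_eag:
  assumes "2 \<le> length I"
  shows "opt I \<le> real (length I) / 2 * aggregate_freq I (eag I)"
proof -
  obtain b where b: "\<And>x. count_list I x \<le> count_list I b"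
    using obtain_most_frequent[of I] by blast
  have "real (2 * count_list I b) \<le> real (\<Sum>t<length I. count_list I (eag I ! t))"
    unfolding of_nat_le_iff by (rule two_max_count_le_eag_sum[OF assms b])
  moreover have "opt I \<le> real (count_list I b)"
    using assms b by (intro opt_le_max_count) auto
  moreover have "real (length I) / 2 * aggregate_freq I (eag I)
      = real (\<Sum>t<length I. count_list I (eag I ! t)) / 2"
    unfolding aggregate_freq_eq_sum_count using assms by simp
  ultimately show ?thesis by simp
qed

lemma competitive_eag: "competitive eag (\<lambda>n. real n / 2)"
  unfolding competitive_def
proof (intro bexI allI impI)
  \<comment> \<open>An input of length 1 has ratio 1, which exceeds \<open>n / 2\<close>.\<close>
  let ?h = "\<lambda>n. if n = 1 then 1 / 2 else 0 :: real"
  show "?h \<in> o(\<lambda>n. real n / 2)"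
  proof -
    have "eventually (\<lambda>n. ?h n = 0) sequentially"
      using eventually_gt_at_top[of 1] by eventually_elim auto
    then have "?h \<in> o(\<lambda>n. real n / 2) \<longleftrightarrow> (\<lambda>_. 0) \<in> o(\<lambda>n. real n / 2)"
      by (rule landau_o.small.in_cong)
    then show ?thesis by simp
  qed
  fix I :: "'a list"
  assume "I \<noteq> []"
  then consider "2 \<le> length I" | a where "I = [a]"
    \<comment> \<open>This case rule separates lists of length 0, 1 and at least 2.\<close>
    by (cases I rule: remdups_adj.cases) auto
  then show "opt I \<le> (real (length I) / 2 + ?h (length I)) * aggregate_freq I (eag I)"
  proof cases
    case 1
    then show ?thesis using opt_le_half_length_eag[of I] by simp
  next
    case 2
    then have "aggregate_freq I (eag I) = 1"
      by (simp add: aggregate_freq_eq_sum_count eag_alt eag_stop_def)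
    moreover have "opt I \<le> real 1"
      by (rule opt_le_max_count) (auto simp: 2)
    ultimately show ?thesis by (simp add: 2)
  qed
qed

section \<open>Lower bound: the adversarial input\<close>

lemma count_list_replicate: "count_list (replicate k x) y = (if x = y then k else 0)"
  by (induction k) auto

lemma eag_adversarial_input:
  fixes x b :: 'a
  assumes "x \<noteq> b" and n: "2 \<le> n"
  defines "I \<equiv> replicate 2 x @ replicate (n - 2) b"
  shows "length I = n" and "aggregate_freq I (eag I) = 2" and "(real n - 2)\<^sup>2 / real n \<le> opt I"
proof -
  show len: "length I = n"
    using n by (simp add: I_def)
  have cx: "count_list I x = 2" and cb: "count_list I b = n - 2"
    using assms by (auto simp: I_def count_list_replicate)
  have adj: "0 + 1 < length I \<and> I ! 0 = I ! (0 + 1)"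
    using n by (simp add: I_def nth_append)
  then have "(LEAST t. t + 1 < length I \<and> I ! t = I ! (t + 1)) = 0"
    by (intro Least_equality) auto
  then have stop: "eag_stop I = 0"
    using adj unfolding eag_stop_def by (metis (mono_tags, lifting))
  have "I ! 0 = x"
    by (simp add: I_def numeral_2_eq_2)
  then have "(\<Sum>t<length I. count_list I (eag I ! t)) = (\<Sum>t<length I. 2)"
    by (intro sum.cong) (auto simp: eag_alt stop cx)
  then show "aggregate_freq I (eag I) = 2"
    unfolding aggregate_freq_eq_sum_count using len n by simp
  have "(\<Sum>t<length I. count_list I (I ! t)) = sum_list (map (count_list I) I)"
    using sum_nth_take[of "length I" I "count_list I"] by simp
  also have "\<dots> = 2 * count_list I x + (n - 2) * count_list I b"
    \<comment> \<open>Only the list summed over is unfolded; the counts in \<open>I\<close> stay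
      folded.\<close>
    by (subst (2) I_def) (simp add: sum_list_replicate)
  also have "\<dots> = 4 + (n - 2)\<^sup>2"
    by (simp add: cx cb power2_eq_square)
  finally have "aggregate_freq I I = real (4 + (n - 2)\<^sup>2) / real n"
    unfolding aggregate_freq_eq_sum_count len by (simp only:)
  also have "\<dots> = (4 + (real n - 2)\<^sup>2) / real n"
    using n by (simp add: of_nat_diff)
  finally have "aggregate_freq I I = (4 + (real n - 2)\<^sup>2) / real n" .
  moreover have "aggregate_freq I I \<le> opt I"
    by (rule aggregate_freq_le_opt) (simp add: buffer_sequence_def)
  moreover have "(real n - 2)\<^sup>2 / real n \<le> (4 + (real n - 2)\<^sup>2) / real n"
    by (intro divide_right_mono) auto
  ultimately show "(real n - 2)\<^sup>2 / real n \<le> opt I"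
    by linarith
qed

text \<open>The adversarial inputs force \<open>(n - 2)\<^sup>2 / n \<le> 2 * (g n + h n)\<close>.
  Absorbing \<open>h n\<close> into \<open>e * g n\<close> bounds the ratio by
  \<open>(1 + e) * (n / (n - 2))\<^sup>2\<close>, which tends to \<open>1 + e\<close>; then
  \<open>e\<close> is made arbitrarily small.\<close>

lemma limsup_half_div_competitive_eag:
  assumes "competitive (eag :: 'a::infinite algorithm) g"
  shows "limsup (\<lambda>n. ereal ((real n / 2) / g n)) \<le> 1"
proof -
  obtain h where h: "h \<in> o(g)"
    and comp: "\<And>I :: 'a list. I \<noteq> [] \<Longrightarrow>
      opt I \<le> (g (length I) + h (length I)) * aggregate_freq I (eag I)"
    using assms unfolding competitive_def by blast
  obtain x b :: 'a where xb: "x \<noteq> b"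
    using ex_new_if_finite[OF infinite_UNIV, of "{b}" for b] by blast
  have lower: "(real n - 2)\<^sup>2 / real n \<le> (g n + h n) * 2" if "2 \<le> n" for n
  proof -
    let ?I = "replicate 2 x @ replicate (n - 2) b"
    note I = eag_adversarial_input[OF xb that]
    have "?I \<noteq> []" by simp
    from comp[OF this] show ?thesis
      using I by simp
  qed
  have bound: "limsup (\<lambda>n. ereal ((real n / 2) / g n)) \<le> ereal (1 + e)"
    if e: "0 < e" "e < 1" for e :: real
  proof -
    have "eventually (\<lambda>n. norm (h n) \<le> e * norm (g n)) sequentially"
      using landau_o.smallD[OF h e(1)] .
    then have ev: "eventually (\<lambda>n. ereal ((real n / 2) / g n)
        \<le> ereal ((1 + e) * (real n / (real n - 2))\<^sup>2)) sequentially"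
      using eventually_ge_at_top[of 3]
    proof eventually_elim
      case (elim n)
      let ?q = "(real n - 2)\<^sup>2 / real n"
      have q: "0 < ?q" using elim by simp
      have l: "?q \<le> (g n + h n) * 2" using lower[of n] elim by simp
      have hn: "h n \<le> e * \<bar>g n\<bar>" using elim by auto
      \<comment> \<open>If \<open>g n \<le> 0\<close>, then \<open>e < 1\<close> gives
        \<open>h n \<le> - g n\<close>, so \<open>g n + h n\<close> could not exceed the positive
        \<open>?q / 2\<close>.\<close>
      have g0: "0 < g n"
      proof (rule ccontr)
        assume "\<not> 0 < g n"
        moreover then have "e * \<bar>g n\<bar> \<le> 1 * \<bar>g n\<bar>" using e by (intro mult_right_mono) auto
        ultimately show False using q l hn by auto
      qed
      then have "?q \<le> 2 * (1 + e) * g n" using l hn by (simp add: algebra_simps)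
      then have "(real n - 2)\<^sup>2 \<le> 2 * (1 + e) * g n * real n"
        using elim by (simp add: divide_le_eq)
      then have "real n * (real n - 2)\<^sup>2 \<le> real n * (2 * (1 + e) * g n * real n)"
        by (rule mult_left_mono) simp
      also have "\<dots> = (1 + e) * (real n)\<^sup>2 * (2 * g n)"
        by (simp add: power2_eq_square)
      finally have "real n / (2 * g n) \<le> (1 + e) * (real n)\<^sup>2 / (real n - 2)\<^sup>2"
        using g0 elim by (subst frac_le_eq) (auto simp: divide_le_0_iff)
      then show ?case by (simp add: power_divide)
    qed
    have "(\<lambda>n. real n / (real n - 2)) \<longlonglongrightarrow> 1"
      by real_asymp
    then have "(\<lambda>n. (1 + e) * (real n / (real n - 2))\<^sup>2) \<longlonglongrightarrow> (1 + e) * 1\<^sup>2"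
      by (intro tendsto_intros)
    then have "limsup (\<lambda>n. ereal ((1 + e) * (real n / (real n - 2))\<^sup>2)) = ereal (1 + e)"
      by (intro lim_imp_Limsup) auto
    then show ?thesis using Limsup_mono[OF ev] by simp
  qed
  show ?thesis
  proof (rule ereal_le_epsilon2)
    fix e :: real
    assume "0 < e"
    \<comment> \<open>The minimum keeps the argument of \<open>bound\<close> below 1.\<close>
    then have "limsup (\<lambda>n. ereal ((real n / 2) / g n)) \<le> ereal (1 + min e (1 / 2))"
      by (intro bound) auto
    also have "\<dots> \<le> 1 + ereal e"
      by (simp add: one_ereal_def)
    finally show "limsup (\<lambda>n. ereal ((real n / 2) / g n)) \<le> 1 + ereal e" .
  qed
qed

theorem theorem4:
  "has_competitive_function (eag :: 'a::infinite algorithm) (\<lambda>n. real n / 2)"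
  unfolding has_competitive_function_def
  using competitive_eag limsup_half_div_competitive_eag by blast

end
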